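(* Let $p$ be a prime, let $r,m\ge 1$, $s\ge 0$ and $e\ge 2$ be integers with $\gcd(m,p)=1$, put $n=mp^s$ and $R=\mathbb{F}_{p^r}[u]/\langle u^e\rangle$. Let $\lambda=\alpha_1+u\alpha_2+\cdots+u^{e-1}\alpha_e$ with $\alpha_1,\dots,\alpha_e\in\mathbb{F}_{p^r}$, where $\alpha_1=\alpha_0^{p^s}\in\mathbb{F}_{p^r}^*$ for some $\alpha_0\in\mathbb{F}_{p^r}$, and $\alpha_2\ne 0$. Then $x^n-\alpha_1=\prod_{i=1}^{l} f_i^{p^s}$ factors uniquely as a product of (powers of) irreducible polynomials $f_1,\dots,f_l$ in $\mathbb{F}_{p^r}[x]$, and $\mathcal{R}=R[x]/\langle x^n-\lambda\rangle$ is a principal ideal ring whose ideals are $$\Big\langle \prod_{i=1}^{l} f_i^{s_i}\Big\rangle,\qquad 0\le s_i\le p^s e .$$ Moreover, the code $\mathcal{C}=\langle\prod_{i=1}^{l} f_i^{s_i}\rangle$ has cardinality $$|\mathcal{C}|=p^{re\left(n-\sum_{i=1}^{l} s_i\deg f_i\right)}.$$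
   Context: $R=\mathbb{F}_{p^r}[u]/\langle u^e\rangle=\mathbb{F}_{p^r}+u\mathbb{F}_{p^r}+\cdots+u^{e-1}\mathbb{F}_{p^r}$ with $u^e=0$ is a finite chain ring with maximal ideal $\langle u\rangle$ and residue field $\mathbb{F}_{p^r}$. For a unit $\lambda\in R$, a $\lambda$-constacyclic code of length $n$ over $R$ is an $R$-submodule of $R^n$ closed under $(c_0,\dots,c_{n-1})\mapsto(\lambda c_{n-1},c_0,\dots,c_{n-2})$; identifying vectors with polynomials of degree less than $n$, these codes are exactly the ideals of $\mathcal{R}=R[x]/\langle x^n-\lambda\rangle$. The polynomials $f_1,\dots,f_l$ are the pairwise coprime monic irreducible factors of $x^m-\alpha_0$ over $\mathbb{F}_{p^r}$.
   Formalization: The printed cardinality p^{re(n - sum s_i deg f_i)} is false (e.g. p=2, r=m=1, s=0, e=2, lambda=1+u, C=<x-1> has 2 elements, not 1); the formal theorem proves the corrected |C| = p^{r(en - sum s_i deg f_i)}. *)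

theory Defs
  imports
    "HOL-Algebra.Algebra"
    "HOL-Algebra.Algebraic_Closure_Type"
    "HOL-Computational_Algebra.Computational_Algebra"
    "HOL-Library.Cardinality"
begin

text \<open>
  The finite field is a type of sorts field and finite, so that polynomials over it are
  the library type of univariate polynomials. The rings built from it are HOL-Algebra records.
\<close>

definition trunc_ideal :: "nat \<Rightarrow> 'a::field poly set" where
  "trunc_ideal e = Idl\<^bsub>ring_of_type_algebra\<^esub> {Polynomial.monom 1 e}"

text \<open>The chain ring $F[u]/(u^e)$; here the polynomial variable plays the role of $u$.\<close>

definition chain_ring :: "nat \<Rightarrow> 'a::field poly set ring" where
  "chain_ring e = ring_of_type_algebra Quot trunc_ideal e"

definition chain_elt :: "nat \<Rightarrow> 'a::field poly \<Rightarrow> 'a poly set" where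
  "chain_elt e q = trunc_ideal e +>\<^bsub>ring_of_type_algebra\<^esub> q"

definition constacyclic_ideal ::
    "nat \<Rightarrow> nat \<Rightarrow> 'a::field poly set \<Rightarrow> (nat \<Rightarrow> 'a poly set) set" where
  "constacyclic_ideal e n lam =
     (let P = UP (chain_ring e)
      in Idl\<^bsub>P\<^esub> {up_ring.monom P \<one>\<^bsub>chain_ring e\<^esub> n \<ominus>\<^bsub>P\<^esub> up_ring.monom P lam 0})"

text \<open>$R[x]/(x^n - \lambda)$ with $R = F[u]/(u^e)$ and \<open>lam\<close> an element of $R$.\<close>

definition constacyclic_ring ::
    "nat \<Rightarrow> nat \<Rightarrow> 'a::field poly set \<Rightarrow> (nat \<Rightarrow> 'a poly set) set ring" where
  "constacyclic_ring e n lam = UP (chain_ring e) Quot constacyclic_ideal e n lam"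

text \<open>
  The image in $R[x]/(x^n - \lambda)$ of a polynomial over $F$, via the inclusion of $F$ in $R$ on
  coefficients. Elements of \<^const>\<open>UP\<close> are coefficient functions, and here the variable of the
  polynomial plays the role of $x$.
\<close>

definition constacyclic_elt ::
    "nat \<Rightarrow> nat \<Rightarrow> 'a::field poly set \<Rightarrow> 'a poly \<Rightarrow> (nat \<Rightarrow> 'a poly set) set" where
  "constacyclic_elt e n lam f =
     constacyclic_ideal e n lam +>\<^bsub>UP (chain_ring e)\<^esub>
       (\<lambda>i. chain_elt e [:Polynomial.coeff f i:])"

definition principal_ideal_ring :: "('a, 'b) ring_scheme \<Rightarrow> bool" where
  "principal_ideal_ring A \<longleftrightarrow> cring A \<and> (\<forall>I. ideal I A \<longrightarrow> principalideal I A)"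

end

theory Submission
  imports Defs "HOL-Number_Theory.Residues"
begin

text \<open>
  Put $G = x^n - \alpha_1$. In $\mathcal{R}$ we have $G = u(\alpha_2 + u\alpha_3 + \cdots) = L(u)$,
  and since $\alpha_2 \neq 0$ the polynomial $L$ has a compositional inverse $w$ modulo $u^e$, so
  $u = w(G)$. Hence $F[x] \to \mathcal{R}$ is already surjective, and its kernel is generated by
  $G^e$: substituting $u = w(G)$ in a representation
  $f = (x^n - \lambda)h + u^e k$ over $F[u][x]$ makes the right-hand side divisible by $G^e$. So
  $\mathcal{R} \cong F[x]/(G^e)$, whose ideals correspond to the monic divisors of
  $G^e = \prod_i f_i^{p^s e}$.
\<close>

subsection \<open>Factorization into monic irreducible polynomials\<close>

text \<open>The inverse of L is needed on both sides, for different purposes. That w(L) = X modulo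
  X^e gives u = w(G), hence surjectivity; that L(w) = X modulo X^e makes x^n - la(w(G)) divisible by
  G^e, hence bounds the kernel. Only the left inverse is constructed; it is a right inverse as well
  because composition with L preserves the order of vanishing at 0. The computations take place over
  F[u] rather than F[u]/(u^e): F[u][x] and F[x] are then both polynomial types, substitution for u
  is a ring homomorphism between them, and u^e is carried along as a second modulus. Record-based
  quotients enter only once the arithmetic is finished. The exponent p^s of the f_i has a separate
  source: gcd(m,p) = 1 makes x^m - alpha_0 squarefree, and Frobenius turns its p^s-th power into x^n
  - alpha_1.\<close>

abbreviation monic_irreducible :: "'a::field poly \<Rightarrow> bool" where
  "monic_irreducible g \<equiv> comm_semiring_1_class.irreducible g \<and> Polynomial.lead_coeff g = 1"

lemma monic_unit_eq_1: "Polynomial.lead_coeff h = 1 \<Longrightarrow> h dvd 1 \<Longrightarrow> h = 1"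
  for h :: "'a::field poly"
  by (auto simp: is_unit_poly_iff pCons_one)

lemma monic_irreducible_dvd_eq:
  assumes "monic_irreducible p" "monic_irreducible q" "p dvd q"
  shows "p = (q :: 'a::field poly)"
proof -
  from assms(3) obtain k where k: "q = p * k" by (elim dvdE)
  with assms(1,2) have "k dvd 1"
    using comm_semiring_1_class.irreducibleD[of q p k] irreducible_not_unit by blast
  moreover have "Polynomial.lead_coeff k = 1"
    using assms(1,2) k by (simp add: Polynomial.lead_coeff_mult)
  ultimately have "k = 1" using monic_unit_eq_1 by blast
  thus ?thesis using k by simp
qed

text \<open>Each irreducible \<open>p\<close> is prime. Taking the factors one at a time, either
  \<open>p\<close> divides \<open>h\<close> and is stripped off and recorded in \<open>B\<close>, or
  \<open>p\<close> divides the cofactor of \<open>h\<close> and cancels there. Monicity excludes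
  stray units.\<close>

lemma monic_dvd_prod_monic_irreducible:
  fixes h :: "'a::field poly"
  assumes "h dvd prod_mset A" "\<forall>g\<in>#A. monic_irreducible g" "Polynomial.lead_coeff h = 1"
  obtains B where "B \<subseteq># A" "h = prod_mset B"
proof -
  have "\<exists>B. B \<subseteq># A \<and> h = prod_mset B" using assms
  proof (induction A arbitrary: h)
    case empty
    thus ?case using monic_unit_eq_1[of h] by auto
  next
    case (add p A)
    have p: "prime_elem p" "Polynomial.lead_coeff p = 1" "p \<noteq> 0"
      using add.prems(2) field_poly_irreducible_imp_prime by auto
    show ?case
    proof (cases "p dvd h")
      case True
      then obtain k where k: "h = p * k" by (elim dvdE)
      with add.prems p(3) have "k dvd prod_mset A" by simp
      moreover have "Polynomial.lead_coeff k = 1"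
        using add.prems(3) p(2) k by (simp add: Polynomial.lead_coeff_mult)
      ultimately obtain B where "B \<subseteq># A" "k = prod_mset B"
        using add.IH add.prems(2) by auto
      thus ?thesis using k by (intro exI[of _ "add_mset p B"]) simp
    next
      case False
      from add.prems(1) obtain k where k: "p * prod_mset A = h * k" by (auto elim: dvdE)
      hence "p dvd k" using p(1) False by (metis dvd_triv_left prime_elem_dvd_mult_iff)
      then obtain k' where "k = p * k'" by (elim dvdE)
      with k p(3) have "prod_mset A = h * k'" by simp
      hence "h dvd prod_mset A" by simp
      then obtain B where "B \<subseteq># A" "h = prod_mset B"
        using add.IH add.prems(2,3) by auto
      thus ?thesis by (metis subset_mset.order_trans mset_subset_eq_add_right add_mset_add_single
            mset_subset_eq_add_left)
    qed
  qed
  thus ?thesis using that by blast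
qed

text \<open>Associated monic polynomials are equal, so unique factorization becomes plain equality
  of multisets, without units.\<close>

lemma monic_irreducible_factorization_unique:
  fixes A B :: "'a::field poly multiset"
  assumes "prod_mset A = prod_mset B"
    and "\<forall>g\<in>#A. monic_irreducible g" "\<forall>g\<in>#B. monic_irreducible g"
  shows "A = B"
  using assms
proof (induction A arbitrary: B)
  case empty
  show ?case
  proof (rule ccontr)
    assume "{#} \<noteq> B"
    then obtain q where q: "q \<in># B" by (metis multiset_nonemptyE)
    hence "q dvd 1" using empty.prems(1) dvd_prod_mset by fastforce
    thus False using empty.prems(3) q irreducible_not_unit by blast
  qed
next
  case (add p A)
  have p: "prime_elem p" "p \<noteq> 0"
    using add.prems(2) field_poly_irreducible_imp_prime by auto
  have "p dvd prod_mset B" using add.prems(1) by (metis dvd_triv_left prod_mset.add_mset)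
  then obtain q where q: "q \<in># B" "p dvd q"
    using p(1) by (elim prime_elem_dvd_prod_msetE)
  have "p = q"
    using q add.prems(2,3) by (intro monic_irreducible_dvd_eq) auto
  with q(1) obtain B' where B': "B = add_mset p B'" by (metis multi_member_split)
  with add.prems(1) p(2) have "prod_mset A = prod_mset B'" by simp
  from add.IH[OF this] add.prems(2,3) B' show ?case by simp
qed

lemma monic_irreducible_factorization_exists:
  fixes h :: "'a::field poly"
  assumes "Polynomial.lead_coeff h = 1"
  obtains A where "\<forall>g\<in>#A. monic_irreducible g" "prod_mset A = h"
proof -
  have "\<exists>A. (\<forall>g\<in>#A. monic_irreducible g) \<and> prod_mset A = h" using assms
  proof (induction "Polynomial.degree h" arbitrary: h rule: less_induct)
    case less
    have nz: "h \<noteq> 0" using less.prems by auto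
    consider "h dvd 1" | "comm_semiring_1_class.irreducible h"
      | a b where "h = a * b" "\<not> a dvd 1" "\<not> b dvd 1"
      using nz unfolding comm_semiring_1_class.irreducible_def by blast
    thus ?case
    proof cases
      case 1
      thus ?thesis using monic_unit_eq_1 less.prems by (intro exI[of _ "{#}"]) auto
    next
      case 2
      thus ?thesis using less.prems by (intro exI[of _ "{#h#}"]) simp
    next
      case (3 a b)
      define a' where "a' = Polynomial.smult (inverse (Polynomial.lead_coeff a)) a"
      define b' where "b' = Polynomial.smult (inverse (Polynomial.lead_coeff b)) b"
      have ab: "a \<noteq> 0" "b \<noteq> 0" using nz 3(1) by auto
      have "Polynomial.degree a > 0" "Polynomial.degree b > 0"
        using 3(2,3) ab by (auto simp: is_unit_iff_degree)
      hence deg: "Polynomial.degree a' < Polynomial.degree h" "Polynomial.degree b' < Polynomial.degree h"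
        using ab by (simp_all add: 3(1) a'_def b'_def Polynomial.degree_mult_eq)
      have lc: "Polynomial.lead_coeff a' = 1" "Polynomial.lead_coeff b' = 1"
        using ab by (simp_all add: a'_def b'_def)
      \<comment> \<open>Since \<open>h\<close> is monic, the two scaling factors cancel in
        \<open>a' * b'\<close>.\<close>
      have "Polynomial.lead_coeff a * Polynomial.lead_coeff b = 1"
        using less.prems 3(1) by (simp add: Polynomial.lead_coeff_mult)
      hence eq: "h = a' * b'"
        by (simp add: 3(1) a'_def b'_def flip: inverse_mult_distrib) (simp add: mult.commute)
      from less.hyps[OF deg(1) lc(1)] less.hyps[OF deg(2) lc(2)]
      obtain A B where "\<forall>g\<in>#A. monic_irreducible g" "prod_mset A = a'"
        "\<forall>g\<in>#B. monic_irreducible g" "prod_mset B = b'" by blast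
      thus ?thesis by (intro exI[of _ "A + B"]) (auto simp: eq)
    qed
  qed
  thus ?thesis using that by blast
qed

section \<open>Binomials: simple factors of x^m - a, and Frobenius powers\<close>

lemma lead_coeff_binomial:
  assumes "n > 0"
  shows "Polynomial.degree (Polynomial.monom 1 n - [:c:]) = n"
    and "Polynomial.lead_coeff (Polynomial.monom 1 n - [:c:] :: 'a::field poly) = 1"
proof -
  show deg: "Polynomial.degree (Polynomial.monom 1 n - [:c:]) = n"
  proof (rule antisym)
    show "Polynomial.degree (Polynomial.monom 1 n - [:c:]) \<le> n"
      by (rule degree_diff_le) (auto simp: degree_monom_le)
    show "n \<le> Polynomial.degree (Polynomial.monom 1 n - [:c:])"
      using assms by (intro le_degree) (auto simp: coeff_pCons split: nat.split)
  qed
  show "Polynomial.lead_coeff (Polynomial.monom 1 n - [:c:] :: 'a::field poly) = 1"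
    using assms unfolding deg by (auto simp: coeff_pCons split: nat.split)
qed

text \<open>A square factor \<open>g ^ 2\<close> would make \<open>g\<close> divide the derivative m
  x^(m-1), hence x^m, hence the difference \<open>[:a:]\<close>, which is a unit.\<close>

lemma binomial_squarefree:
  fixes g :: "'a::field poly"
  assumes "comm_semiring_1_class.irreducible g" "of_nat m \<noteq> (0 :: 'a)" "a \<noteq> 0"
  shows "\<not> g ^ 2 dvd Polynomial.monom 1 m - [:a:]"
proof
  assume dvd: "g ^ 2 dvd Polynomial.monom 1 m - [:a:]"
  then obtain k where k: "Polynomial.monom 1 m - [:a:] = g ^ 2 * k" by (elim dvdE)
  have prime: "prime_elem g" using assms(1) by (rule field_poly_irreducible_imp_prime)
  have "g dvd pderiv (g ^ 2 * k)"
    by (simp add: pderiv_mult power2_eq_square)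
  hence "g dvd Polynomial.smult (of_nat m) (Polynomial.monom 1 (m - 1))"
    unfolding k[symmetric] by (simp add: pderiv_diff pderiv_monom pderiv_pCons Polynomial.smult_monom)
  hence "g dvd Polynomial.monom 1 (m - 1)"
    using assms(2) by (simp add: Polynomial.dvd_smult_iff)
  hence "g dvd Polynomial.monom 1 1 * Polynomial.monom 1 (m - 1)" by (rule dvd_mult)
  moreover have "m > 0" using assms(2) by (cases m) auto
  ultimately have "g dvd Polynomial.monom 1 m" by (simp add: Polynomial.mult_monom)
  moreover have "g dvd Polynomial.monom 1 m - [:a:]"
    using dvd by (rule dvd_trans[rotated]) (simp add: power2_eq_square)
  ultimately have "g dvd Polynomial.monom 1 m - (Polynomial.monom 1 m - [:a:])"
    by (rule dvd_diff)
  hence "g dvd [:a:]" by simp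
  moreover have "[:a:] dvd 1" using assms(3) by (simp add: is_unit_iff_degree)
  ultimately have "g dvd 1" by (rule dvd_trans)
  thus False using assms(1) irreducible_not_unit by blast
qed

lemma binomial_factorization:
  fixes a :: "'a::field" and f :: "'i \<Rightarrow> 'a poly"
  assumes "of_nat m \<noteq> (0 :: 'a)" "a \<noteq> 0"
    and bij: "bij_betw f J {g. comm_semiring_1_class.irreducible g \<and> Polynomial.lead_coeff g = 1 \<and>
               g dvd Polynomial.monom 1 m - [:a:]}"
  shows "Polynomial.monom 1 m - [:a:] = prod f J"
proof -
  have "m > 0" using assms(1) by (cases m) auto
  then obtain A where A: "\<forall>g\<in>#A. monic_irreducible g" "prod_mset A = Polynomial.monom 1 m - [:a:]"
    using monic_irreducible_factorization_exists lead_coeff_binomial by blast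
  have "count A g \<le> 1" for g
  proof (rule ccontr)
    assume "\<not> count A g \<le> 1"
    hence "replicate_mset 2 g \<subseteq># A" and "g \<in># A"
      by (auto simp flip: count_le_replicate_mset_subset_eq count_greater_zero_iff)
    hence "g ^ 2 dvd prod_mset A" using prod_mset_subset_imp_dvd by fastforce
    with binomial_squarefree[OF _ assms(1,2), of g] A \<open>g \<in># A\<close> show False by metis
  qed
  \<comment> \<open>With all multiplicities at most 1, the multiset is its underlying set, and that
    set is what \<open>f\<close> enumerates.\<close>
  hence A_set: "A = mset_set (set_mset A)"
    by (intro multiset_eqI) (metis count_greater_eq_one_iff count_mset_set(1,3) finite_set_mset
        le_antisym not_in_iff)
  have "set_mset A = {g. monic_irreducible g \<and> g dvd prod_mset A}"
  proof (intro equalityI subsetI)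
    fix g assume g: "g \<in> {g. monic_irreducible g \<and> g dvd prod_mset A}"
    hence "prime_elem g" "g dvd prod_mset A" using field_poly_irreducible_imp_prime by blast+
    then obtain q where "q \<in># A" "g dvd q" by (rule prime_elem_dvd_prod_msetE)
    thus "g \<in># A" using g A(1) monic_irreducible_dvd_eq by blast
  qed (use A(1) dvd_prod_mset in auto)
  hence "bij_betw f J (set_mset A)" using bij by (simp add: A(2) conj_assoc)
  hence "prod f J = prod (\<lambda>g. g) (set_mset A)" by (rule prod.reindex_bij_betw)
  also have "\<dots> = prod_mset A" by (subst (2) A_set) (simp add: prod_unfold_prod_mset)
  finally show ?thesis using A(2) by simp
qed

lemma CHAR_eq_of_CARD_eq_prime_power:
  assumes "normalization_semidom_class.prime p" and "CARD('a::{field,finite}) = p ^ r"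
  shows "CHAR('a) = p"
proof -
  have "normalization_semidom_class.prime CHAR('a)"
    by (rule prime_CHAR_semidom) (simp add: finite_imp_CHAR_pos)
  moreover have "CHAR('a) dvd p ^ r" using CHAR_dvd_CARD[where ?'a = 'a] assms(2) by simp
  ultimately show ?thesis
    using assms(1) by (metis prime_dvd_power primes_dvd_imp_eq)
qed

lemma binomial_power_char:
  fixes a :: "'a::field" and s :: nat
  assumes "normalization_semidom_class.prime CHAR('a)"
  defines "q \<equiv> CHAR('a) ^ s"
  shows "(Polynomial.monom 1 m - [:a:]) ^ q = Polynomial.monom 1 (m * q) - [:a ^ q:]"
proof -
  \<comment> \<open>The additive identity is applied to (x^m - a) + a = x^m, so that the sign of
    (-a)^q never has to be discussed.\<close>
  have "(Polynomial.monom 1 m - [:a:] + [:a:]) ^ q = (Polynomial.monom 1 m - [:a:]) ^ q + [:a:] ^ q"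
    by (rule freshmans_dream') (use assms in simp_all)
  thus ?thesis by (simp add: poly_const_pow monom_power algebra_simps)
qed

subsection \<open>The congruence on $F[u][x]$\<close>

lemma pcompose_diff_dvd:
  fixes q a b :: "'a::comm_ring_1 poly"
  shows "a - b dvd pcompose q a - pcompose q b"
proof (induction q)
  case (pCons c q)
  have "pcompose (pCons c q) a - pcompose (pCons c q) b
      = (a - b) * pcompose q a + b * (pcompose q a - pcompose q b)"
    by (simp add: pcompose_pCons algebra_simps)
  with pCons show ?case
    by (metis dvd_add dvd_mult dvd_triv_left)
qed simp

lemma pcompose_monom: "pcompose (Polynomial.monom c k) p = Polynomial.smult c (p ^ k)"
  for p :: "'a::comm_semiring_1 poly"
  by (induction k) (simp_all add: Polynomial.monom_0 Polynomial.monom_Suc pcompose_pCons)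

lemma pCons_0_dvd_iff: "[:0, 1:] dvd p \<longleftrightarrow> Polynomial.coeff p 0 = 0"
  for p :: "'a::comm_ring_1 poly"
  using poly_eq_0_iff_dvd[of p 0] by (simp add: poly_0_coeff_0)

lemma monom_1_eq_X_power: "Polynomial.monom 1 k = [:0, 1::'a::comm_semiring_1:] ^ k"
  by (induction k) (simp_all add: Polynomial.monom_0 Polynomial.monom_Suc pCons_one)

text \<open>A nonzero constant term makes \<open>v\<close> invertible as a power series, so it
  cancels modulo powers of X. The proof peels off one factor X at a time instead of inverting
  \<open>v\<close>.\<close>

lemma X_power_dvd_multD:
  fixes v y :: "'a::idom poly"
  assumes "[:0, 1:] ^ k dvd v * y" and "Polynomial.coeff v 0 \<noteq> 0"
  shows "[:0, 1:] ^ k dvd y"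
  using assms(1)
proof (induction k arbitrary: y)
  case (Suc k)
  from Suc.prems have "[:0, 1:] dvd v * y"
    by (metis dvd_mult_left power_Suc)
  hence "Polynomial.coeff y 0 = 0"
    using assms(2) by (simp add: pCons_0_dvd_iff coeff_mult_0)
  then obtain z where z: "y = [:0, 1:] * z"
    unfolding pCons_0_dvd_iff[symmetric] by (elim dvdE)
  from Suc.prems have "[:0, 1:] * [:0, 1:] ^ k dvd [:0, 1:] * (v * z)"
    unfolding z power_Suc by (simp only: mult.left_commute)
  hence "[:0, 1:] ^ k dvd v * z"
    by (subst (asm) dvd_mult_cancel_left) auto
  from Suc.IH[OF this] show ?case
    unfolding z power_Suc by (rule mult_dvd_mono[OF dvd_refl])
qed simp

context
  fixes L :: "'a::field poly"
  assumes L0: "Polynomial.coeff L 0 = 0" and L1: "Polynomial.coeff L 1 \<noteq> 0"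
begin

lemma local_parameter_factor:
  obtains v where "L = [:0, 1:] * v" and "Polynomial.coeff v 0 \<noteq> 0"
proof -
  from L0 obtain v where v: "L = [:0, 1:] * v"
    unfolding pCons_0_dvd_iff[symmetric] by (elim dvdE)
  moreover have "Polynomial.coeff v 0 \<noteq> 0"
    using L1 unfolding v by simp
  ultimately show ?thesis by (rule that)
qed

text \<open>Successive approximation: a solution modulo X^k is corrected by a term of degree
  \<open>k\<close> to a solution modulo X^(k+1).\<close>

lemma pcompose_left_inverse_mod:
  obtains w where "[:0, 1:] ^ k dvd pcompose w L - [:0, 1:]"
proof -
  obtain v where v: "L = [:0, 1:] * v" "Polynomial.coeff v 0 \<noteq> 0"
    by (rule local_parameter_factor)
  have "\<exists>w. [:0, 1:] ^ k dvd pcompose w L - [:0, 1:]"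
  proof (induction k)
    case (Suc k)
    then obtain w d where d: "pcompose w L - [:0, 1:] = [:0, 1:] ^ k * d"
      by (elim exE dvdE)
    \<comment> \<open>As L^k = X^k v^k, adding c X^k to \<open>w\<close> changes the error
      coefficient at X^k by c v(0)^k; this \<open>c\<close> cancels d(0).\<close>
    define c where "c = - Polynomial.coeff d 0 / Polynomial.coeff v 0 ^ k"
    have "pcompose (w + Polynomial.monom c k) L - [:0, 1:]
        = pcompose w L - [:0, 1:] + Polynomial.smult c (L ^ k)"
      by (simp only: pcompose_add pcompose_monom) (simp only: algebra_simps)
    also have "\<dots> = [:0, 1:] ^ k * (d + Polynomial.smult c (v ^ k))"
      unfolding d by (simp only: v(1) power_mult_distrib distrib_left mult_smult_right)
    finally have eq: "pcompose (w + Polynomial.monom c k) L - [:0, 1:]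
        = [:0, 1:] ^ k * (d + Polynomial.smult c (v ^ k))" .
    have "Polynomial.coeff (d + Polynomial.smult c (v ^ k)) 0 = 0"
      using v(2) by (simp add: coeff_0_power c_def)
    hence "[:0, 1:] dvd d + Polynomial.smult c (v ^ k)"
      by (simp only: pCons_0_dvd_iff)
    hence "[:0, 1:] ^ Suc k dvd pcompose (w + Polynomial.monom c k) L - [:0, 1:]"
      unfolding eq power_Suc2 by (rule mult_dvd_mono[OF dvd_refl])
    thus ?case by blast
  qed simp
  thus ?thesis using that by blast
qed

text \<open>Composition with L = X v, where v(0) is nonzero, does not raise the order of vanishing
  at 0: for d = X z one gets d(L) = X v z(L), and \<open>v\<close> cancels.\<close>

lemma X_power_dvd_pcomposeD:
  assumes "[:0, 1:] ^ k dvd pcompose d L"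
  shows "[:0, 1:] ^ k dvd d"
proof -
  obtain v where v: "L = [:0, 1:] * v" "Polynomial.coeff v 0 \<noteq> 0"
    by (rule local_parameter_factor)
  show ?thesis using assms
  proof (induction k arbitrary: d)
    case (Suc k)
    from Suc.prems have "[:0, 1:] dvd pcompose d L"
      by (metis dvd_mult_left power_Suc)
    hence "Polynomial.coeff d 0 = 0"
      using L0 unfolding pCons_0_dvd_iff by (metis poly_0_coeff_0 poly_pcompose)
    then obtain z where z: "d = [:0, 1:] * z"
      unfolding pCons_0_dvd_iff[symmetric] by (elim dvdE)
    have "pcompose d L = [:0, 1:] * (v * pcompose z L)"
      unfolding z pcompose_mult by (simp add: pcompose_pCons v(1))
    with Suc.prems have "[:0, 1:] * [:0, 1:] ^ k dvd [:0, 1:] * (v * pcompose z L)"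
      unfolding power_Suc by (simp only:)
    hence "[:0, 1:] ^ k dvd v * pcompose z L"
      by (subst (asm) dvd_mult_cancel_left) auto
    hence "[:0, 1:] ^ k dvd z"
      using X_power_dvd_multD[OF _ v(2)] Suc.IH by blast
    thus ?case
      unfolding z power_Suc by (rule mult_dvd_mono[OF dvd_refl])
  qed simp
qed

text \<open>Composing L(w) - X with L gives L(w(L)) - L(X), which is divisible by w(L) - X and hence
  by X^k. The composition with L is then cancelled by \<open>X_power_dvd_pcomposeD\<close>.\<close>

lemma pcompose_right_inverse_mod:
  assumes "[:0, 1:] ^ k dvd pcompose w L - [:0, 1:]"
  shows "[:0, 1:] ^ k dvd pcompose L w - [:0, 1:]"
proof (rule X_power_dvd_pcomposeD)
  have "pcompose (pcompose L w - [:0, 1:]) L = pcompose L (pcompose w L) - pcompose L [:0, 1:]"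
    by (simp add: pcompose_diff pcompose_assoc pcompose_pCons)
  thus "[:0, 1:] ^ k dvd pcompose (pcompose L w - [:0, 1:]) L"
    using dvd_trans[OF assms pcompose_diff_dvd] by metis
qed

end

section \<open>Passing between F[x] and F[u][x]\<close>

definition lift_poly :: "'a::comm_ring_1 poly \<Rightarrow> 'a poly poly" where
  "lift_poly = map_poly (\<lambda>c. [:c:])"

lemma coeff_lift_poly [simp]: "Polynomial.coeff (lift_poly f) i = [:Polynomial.coeff f i:]"
  by (simp add: lift_poly_def coeff_map_poly)

lemma lift_poly_0 [simp]: "lift_poly 0 = 0"
  and lift_poly_1 [simp]: "lift_poly 1 = 1"
  and lift_poly_add: "lift_poly (f + g) = lift_poly f + lift_poly g"
  and lift_poly_diff: "lift_poly (f - g) = lift_poly f - lift_poly g"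
  and lift_poly_pCons: "lift_poly (pCons c f) = pCons [:c:] (lift_poly f)"
  and lift_poly_monom: "lift_poly (Polynomial.monom c n) = Polynomial.monom [:c:] n"
  by (rule poly_eqI; simp add: coeff_pCons split: nat.split)+

lemma lift_poly_smult: "lift_poly (Polynomial.smult c g) = Polynomial.smult [:c:] (lift_poly g)"
  by (rule poly_eqI) simp

lemma lift_poly_mult: "lift_poly (f * g) = lift_poly f * lift_poly g"
  by (induction f) (simp_all add: lift_poly_add lift_poly_smult lift_poly_pCons)

lemma lift_poly_power: "lift_poly (f ^ k) = lift_poly f ^ k"
  by (induction k) (simp_all add: lift_poly_mult)

text \<open>Evaluation u := W(x), x := x, a homomorphism F[u][x] -> F[x] that is left inverse to
  \<open>lift_poly\<close>. The inner polynomials are in u while \<open>W\<close> is read in x,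
  although both have the same type.\<close>

definition subst_coeffs :: "'a::comm_ring_1 poly \<Rightarrow> 'a poly poly \<Rightarrow> 'a poly" where
  "subst_coeffs W P = poly (map_poly (\<lambda>q. pcompose q W) P) [:0, 1:]"

lemma subst_coeffs_0 [simp]: "subst_coeffs W 0 = 0"
  by (simp add: subst_coeffs_def)

lemma subst_coeffs_pCons:
  "subst_coeffs W (pCons q P) = pcompose q W + [:0, 1:] * subst_coeffs W P"
  by (simp add: subst_coeffs_def map_poly_pCons)

lemma subst_coeffs_add: "subst_coeffs W (P + Q) = subst_coeffs W P + subst_coeffs W Q"
  by (induction P Q rule: poly_induct2)
     (simp_all add: subst_coeffs_pCons pcompose_add algebra_simps)

lemma subst_coeffs_smult:
  "subst_coeffs W (Polynomial.smult q P) = pcompose q W * subst_coeffs W P"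
  by (induction P) (simp_all add: subst_coeffs_pCons pcompose_mult algebra_simps)

lemma subst_coeffs_mult: "subst_coeffs W (P * Q) = subst_coeffs W P * subst_coeffs W Q"
  by (induction P)
     (simp_all add: subst_coeffs_pCons subst_coeffs_smult subst_coeffs_add algebra_simps)

lemma subst_coeffs_lift_poly: "subst_coeffs W (lift_poly f) = f"
  by (induction f) (simp_all add: lift_poly_pCons subst_coeffs_pCons)

lemma subst_coeffs_diff: "subst_coeffs W (P - Q) = subst_coeffs W P - subst_coeffs W Q"
  using subst_coeffs_add[of W "P - Q" Q] by simp

text \<open>
  Congruence modulo $(u^e, x^n - \lambda)$ in $F[u][x]$: the inner variable is $u$, the outer one $x$.
\<close>

definition constacyclic_cong :: "nat \<Rightarrow> nat \<Rightarrow> 'a::comm_ring_1 poly \<Rightarrow> 'a poly poly \<Rightarrow> 'a poly poly \<Rightarrow> bool" where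
  "constacyclic_cong e n la P Q \<longleftrightarrow>
     (\<exists>a b. P - Q = a * [:Polynomial.monom 1 e:] + b * (Polynomial.monom 1 n - [:la:]))"

lemma constacyclic_cong_refl [simp]: "constacyclic_cong e n la P P"
  unfolding constacyclic_cong_def by (intro exI[of _ 0]) simp

lemma constacyclic_cong_mult_left:
  assumes "constacyclic_cong e n la P Q" shows "constacyclic_cong e n la (R * P) (R * Q)"
proof -
  from assms obtain a b
    where "P - Q = a * [:Polynomial.monom 1 e:] + b * (Polynomial.monom 1 n - [:la:])"
    unfolding constacyclic_cong_def by blast
  hence "R * P - R * Q = (R * a) * [:Polynomial.monom 1 e:] + (R * b) * (Polynomial.monom 1 n - [:la:])"
    by (simp only: right_diff_distrib[symmetric] distrib_left mult.assoc)
  thus ?thesis unfolding constacyclic_cong_def by blast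
qed

lemma constacyclic_cong_add:
  assumes "constacyclic_cong e n la P Q" "constacyclic_cong e n la P' Q'"
  shows "constacyclic_cong e n la (P + P') (Q + Q')"
proof -
  from assms obtain a b a' b'
    where 1: "P - Q = a * [:Polynomial.monom 1 e:] + b * (Polynomial.monom 1 n - [:la:])"
      and 2: "P' - Q' = a' * [:Polynomial.monom 1 e:] + b' * (Polynomial.monom 1 n - [:la:])"
    unfolding constacyclic_cong_def by blast
  have "(P + P') - (Q + Q') = (P - Q) + (P' - Q')" by simp
  also have "\<dots> = (a + a') * [:Polynomial.monom 1 e:] + (b + b') * (Polynomial.monom 1 n - [:la:])"
    unfolding 1 2 by (simp only: distrib_right add_ac)
  finally show ?thesis unfolding constacyclic_cong_def by blast
qed

lemma constacyclic_cong_sym: "constacyclic_cong e n la P Q \<Longrightarrow> constacyclic_cong e n la Q P"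
  using constacyclic_cong_add[OF constacyclic_cong_mult_left[of e n la P Q "-1"] constacyclic_cong_refl[of e n la "P + Q"]]
  by simp

lemma constacyclic_cong_trans [trans]: "constacyclic_cong e n la P Q \<Longrightarrow> constacyclic_cong e n la Q R \<Longrightarrow> constacyclic_cong e n la P R"
  using constacyclic_cong_add[OF constacyclic_cong_add[of e n la P Q Q R] constacyclic_cong_refl[of e n la "-Q"]]
  by simp

lemma constacyclic_cong_mult:
  assumes "constacyclic_cong e n la P Q" "constacyclic_cong e n la P' Q'"
  shows "constacyclic_cong e n la (P * P') (Q * Q')"
  using constacyclic_cong_trans[OF constacyclic_cong_mult_left[OF assms(2), of P] constacyclic_cong_mult_left[OF assms(1), of Q',
    unfolded mult.commute[of Q']]] .

lemma constacyclic_cong_power: "constacyclic_cong e n la P Q \<Longrightarrow> constacyclic_cong e n la (P ^ k) (Q ^ k)"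
  by (induction k) (auto intro: constacyclic_cong_mult)

lemma constacyclic_cong_monom: "constacyclic_cong e n la (Polynomial.monom 1 n) [:la:]"
  unfolding constacyclic_cong_def by (rule exI[of _ 0], rule exI[of _ 1]) simp

lemma constacyclic_cong_const: "[:0, 1:] ^ e dvd q - q' \<Longrightarrow> constacyclic_cong e n la [:q:] [:q':]"
  unfolding constacyclic_cong_def
  by (elim dvdE, rule_tac x = "[:k:]" in exI, rule exI[of _ 0])
     (simp add: monom_1_eq_X_power mult.commute)

text \<open>For g = G and q = w this carries the relation G = L(u) over to w(G) = w(L(u)).\<close>

lemma lift_poly_pcompose_cong:
  assumes "constacyclic_cong e n la (lift_poly g) [:L:]"
  shows "constacyclic_cong e n la (lift_poly (pcompose q g)) [:pcompose q L:]"
proof (induction q)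
  case (pCons c q)
  have "constacyclic_cong e n la (lift_poly [:c:] + lift_poly g * lift_poly (pcompose q g))
     ([:[:c:]:] + [:L:] * [:pcompose q L:])"
    by (intro constacyclic_cong_add constacyclic_cong_mult assms pCons.IH) (simp add: lift_poly_pCons)
  thus ?case
    by (simp add: pcompose_pCons lift_poly_add lift_poly_mult mult.commute[of L])
qed simp

text \<open>Surjectivity and kernel of F[x] -> F[u][x]/(u^e, x^n - la), phrased as congruences so
  that no quotient has to be formed.\<close>

lemma lift_poly_constacyclic:
  fixes la :: "'a::field poly" and n :: nat
  assumes la1: "Polynomial.coeff la 1 \<noteq> 0" and e: "e > 0"
  defines "G \<equiv> Polynomial.monom 1 n - [:Polynomial.coeff la 0:]"
  shows "\<exists>f. constacyclic_cong e n la P (lift_poly f)"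
    and "constacyclic_cong e n la (lift_poly f) 0 \<longleftrightarrow> G ^ e dvd f"
proof -
  define L where "L = la - [:Polynomial.coeff la 0:]"
  have L: "Polynomial.coeff L 0 = 0" "Polynomial.coeff L 1 \<noteq> 0"
    using la1 by (simp_all add: L_def)
  obtain w where w: "[:0, 1:] ^ e dvd pcompose w L - [:0, 1:]"
    by (rule pcompose_left_inverse_mod[OF L])
  define W where "W = pcompose w G"
  \<comment> \<open>Evaluating at 0 gives w(L(0)) = w(0) = 0; this is what makes G divide W further
    down.\<close>
  have "[:0, 1:] dvd pcompose w L - [:0, 1:]"
    using e by (intro dvd_trans[OF dvd_power w]) simp
  hence w0: "[:0, 1:] dvd w"
    using L(1) unfolding pCons_0_dvd_iff
    by (simp add: poly_0_coeff_0[symmetric] poly_pcompose)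
  have G_cong: "constacyclic_cong e n la (lift_poly G) [:L:]"
  proof -
    have "constacyclic_cong e n la (Polynomial.monom 1 n + - [:[:Polynomial.coeff la 0:]:])
      ([:la:] + - [:[:Polynomial.coeff la 0:]:])"
      by (intro constacyclic_cong_add constacyclic_cong_monom constacyclic_cong_refl)
    moreover have "lift_poly G = Polynomial.monom 1 n - [:[:Polynomial.coeff la 0:]:]"
      by (simp add: G_def lift_poly_diff lift_poly_monom lift_poly_pCons pCons_one)
    moreover have "[:L:] = [:la:] - [:[:Polynomial.coeff la 0:]:]"
      by (simp add: L_def)
    ultimately show ?thesis by (simp only: diff_conv_add_uminus)
  qed
  \<comment> \<open>The left inverse at work: w(G) = w(L(u)) = u.\<close>
  have u_cong: "constacyclic_cong e n la [:[:0, 1:]:] (lift_poly W)"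
    unfolding W_def using lift_poly_pcompose_cong[OF G_cong] constacyclic_cong_const[OF w]
      constacyclic_cong_sym constacyclic_cong_trans by blast
  have const_cong: "constacyclic_cong e n la [:q:] (lift_poly (pcompose q W))" for q
  proof (induction q)
    case (pCons c q)
    have "constacyclic_cong e n la ([:[:c:]:] + [:[:0, 1:]:] * [:q:])
       (lift_poly [:c:] + lift_poly W * lift_poly (pcompose q W))"
      by (intro constacyclic_cong_add constacyclic_cong_mult u_cong pCons.IH) (simp add: lift_poly_pCons)
    thus ?case
      by (simp add: pcompose_pCons lift_poly_add lift_poly_mult)
  qed simp
  have "constacyclic_cong e n la P (lift_poly (subst_coeffs W P))"
  proof (induction P)
    case (pCons q P)
    have "constacyclic_cong e n la ([:q:] + [:0, 1:] * P)
       (lift_poly (pcompose q W) + [:0, 1:] * lift_poly (subst_coeffs W P))"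
      by (intro constacyclic_cong_add constacyclic_cong_mult_left const_cong pCons.IH)
    thus ?case
      by (simp add: subst_coeffs_pCons lift_poly_add lift_poly_mult lift_poly_pCons pCons_one)
  qed simp
  thus "\<exists>f. constacyclic_cong e n la P (lift_poly f)" by blast
  show "constacyclic_cong e n la (lift_poly f) 0 \<longleftrightarrow> G ^ e dvd f"
  proof
    assume "constacyclic_cong e n la (lift_poly f) 0"
    then obtain a b where
      "lift_poly f = a * [:Polynomial.monom 1 e:] + b * (Polynomial.monom 1 n - [:la:])"
      unfolding constacyclic_cong_def by auto
    \<comment> \<open>Substituting \<open>W\<close> for u turns the congruence into an identity in
      F[x]: u^e becomes W^e, la becomes la(W), and the lifted \<open>f\<close> becomes
      \<open>f\<close> again.\<close>
    hence "subst_coeffs W (lift_poly f) =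
        subst_coeffs W (a * [:Polynomial.monom 1 e:] + b * (Polynomial.monom 1 n - [:la:]))"
      by (rule arg_cong)
    also have "\<dots> = subst_coeffs W a * W ^ e
        + subst_coeffs W b * (subst_coeffs W (Polynomial.monom 1 n) - pcompose la W)"
      by (simp add: subst_coeffs_add subst_coeffs_mult subst_coeffs_diff subst_coeffs_pCons
          subst_coeffs_smult pcompose_monom)
    also have "subst_coeffs W (Polynomial.monom 1 n) = Polynomial.monom 1 n"
      using subst_coeffs_lift_poly[of W "Polynomial.monom 1 n"]
      by (simp add: lift_poly_monom pCons_one)
    finally have f: "f = subst_coeffs W a * W ^ e
        + subst_coeffs W b * (Polynomial.monom 1 n - pcompose la W)"
      by (simp only: subst_coeffs_lift_poly)
    have "pcompose [:0, 1:] G dvd W"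
      unfolding W_def using w0 by (metis dvd_def pcompose_mult)
    hence "G ^ e dvd W ^ e"
      by (intro dvd_power_same) (simp add: pcompose_pCons)
    moreover have "G ^ e dvd Polynomial.monom 1 n - pcompose la W"
    proof -
      \<comment> \<open>The right inverse, evaluated at G: L(w(G)) - G = la(W) - x^n.\<close>
      have "pcompose ([:0, 1:] ^ e) G dvd pcompose (pcompose L w - [:0, 1:]) G"
        using pcompose_right_inverse_mod[OF L w] by (metis dvd_def pcompose_mult)
      moreover have "pcompose ([:0, 1:] ^ e) G = G ^ e"
        by (simp add: pcompose_monom flip: monom_1_eq_X_power)
      moreover have "pcompose (pcompose L w - [:0, 1:]) G = - (Polynomial.monom 1 n - pcompose la W)"
        by (simp add: L_def G_def W_def pcompose_diff pcompose_assoc pcompose_pCons)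
      ultimately show ?thesis by (simp only: dvd_minus_iff)
    qed
    ultimately show "G ^ e dvd f"
      unfolding f by (intro dvd_add dvd_mult)
  next
    assume "G ^ e dvd f"
    then obtain h where h: "f = h * G ^ e" by (metis dvdE mult.commute)
    \<comment> \<open>G is congruent to L(u), and L has no constant term, so G^e is congruent to a
      multiple of u^e.\<close>
    have "[:0, 1:] ^ e dvd L ^ e"
      using L(1) by (intro dvd_power_same) (simp only: pCons_0_dvd_iff)
    hence "constacyclic_cong e n la [:L ^ e:] [:0:]"
      by (intro constacyclic_cong_const) simp
    moreover have "[:L ^ e:] = [:L:] ^ e" by (simp add: poly_const_pow)
    ultimately have "constacyclic_cong e n la (lift_poly G ^ e) 0"
      using constacyclic_cong_trans[OF constacyclic_cong_power[OF G_cong, of e]] by simp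
    from constacyclic_cong_mult_left[OF this, of "lift_poly h"]
    show "constacyclic_cong e n la (lift_poly f) 0"
      by (simp add: h lift_poly_mult lift_poly_power)
  qed
qed

subsection \<open>The quotient ring as an image of $F[x]$\<close>

lemma ring_of_type_algebra_simps [simp]:
  "carrier ring_of_type_algebra = UNIV"
  "x \<otimes>\<^bsub>ring_of_type_algebra\<^esub> y = x * y"
  "\<one>\<^bsub>ring_of_type_algebra\<^esub> = 1"
  "\<zero>\<^bsub>ring_of_type_algebra\<^esub> = 0"
  "x \<oplus>\<^bsub>ring_of_type_algebra\<^esub> y = x + y"
  by (simp_all add: ring_of_type_algebra_def)

lemma genideal_type_algebra:
  fixes a :: "'a::comm_ring_1"
  shows "Idl\<^bsub>ring_of_type_algebra\<^esub> {a} = {x. a dvd x}"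
proof -
  interpret R: cring "ring_of_type_algebra :: 'a ring" by (rule cring_from_type_algebra)
  have "Idl\<^bsub>ring_of_type_algebra\<^esub> {a} = PIdl\<^bsub>ring_of_type_algebra\<^esub> a"
    by (rule R.cgenideal_eq_genideal[symmetric]) simp
  also have "\<dots> = {x. a dvd x}"
    by (auto simp: cgenideal_def dvd_def mult.commute)
  finally show ?thesis .
qed

lemma FactRing_zero: "\<zero>\<^bsub>R Quot I\<^esub> = I"
  by (simp add: FactRing_def)

lemma (in ideal) rcos_eq_zero_iff:
  assumes "x \<in> carrier R"
  shows "I +> x = \<zero>\<^bsub>R Quot I\<^esub> \<longleftrightarrow> x \<in> I"
  unfolding FactRing_zero
  using a_coset_join1[OF _ assms a_subgroup] a_rcos_const[of x] by blast

lemma (in ideal) rcos_surj: "(+>) I ` carrier R = carrier (R Quot I)"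
  by (auto simp: FactRing_def A_RCOSETS_def')

text \<open>A bridge between two styles of algebra: the source is a type of class
  \<open>comm_ring_1\<close>, the target a record. The chain ring, its polynomial ring and the
  constacyclic ring are all handled as images of such maps, so computations stay in the
  source.\<close>

locale type_ring_hom_cring = S: cring S for S :: "('b, 'c) ring_scheme" (structure) +
  fixes h :: "'a::comm_ring_1 \<Rightarrow> 'b"
  assumes hom: "h \<in> ring_hom ring_of_type_algebra S"
begin

lemma h_closed [simp, intro]: "h x \<in> carrier S"
  using ring_hom_closed[OF hom] by simp

lemma h_mult: "h (x * y) = h x \<otimes> h y"
  using ring_hom_mult[OF hom] by simp

lemma h_add: "h (x + y) = h x \<oplus> h y"
  using ring_hom_add[OF hom] by simp

lemma h_one [simp]: "h 1 = \<one>"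
  using ring_hom_one[OF hom] by simp

lemma h_zero [simp]: "h 0 = \<zero>"
  using ring_hom_zero[OF hom ring_from_type_algebra S.ring_axioms] by simp

lemma h_diff: "h (x - y) = h x \<ominus> h y"
proof -
  have "h x = h (x - y) \<oplus> h y" by (simp flip: h_add)
  hence "h x \<ominus> h y = h (x - y) \<oplus> (h y \<oplus> \<ominus> h y)"
    by (simp only: S.minus_eq S.a_assoc h_closed S.a_inv_closed)
  thus ?thesis by (simp add: S.r_neg)
qed

lemma h_sum: "finite A \<Longrightarrow> h (sum g A) = (\<Oplus>i\<in>A. h (g i))"
  by (induction A rule: finite_induct) (auto simp: h_add S.finsum_insert)

definition hom_poly :: "'a poly \<Rightarrow> nat \<Rightarrow> 'b" where
  "hom_poly P i = h (Polynomial.coeff P i)"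

interpretation UP_cring S "UP S"
  by unfold_locales simp

lemma hom_poly_closed: "hom_poly P \<in> up S"
proof (rule mem_upI)
  have "bound \<zero> (Polynomial.degree P) (hom_poly P)"
    by (auto simp: hom_poly_def coeff_eq_0)
  thus "\<exists>n. bound \<zero> n (hom_poly P)" ..
qed (simp add: hom_poly_def)

lemma hom_poly_hom: "type_ring_hom_cring (UP S) hom_poly"
proof (unfold_locales, rule ring_hom_memI)
  fix P Q :: "'a poly"
  show "hom_poly P \<in> carrier (UP S)" using hom_poly_closed by (simp add: UP_def)
  show "hom_poly (P \<otimes>\<^bsub>ring_of_type_algebra\<^esub> Q) = hom_poly P \<otimes>\<^bsub>UP S\<^esub> hom_poly Q"
    using hom_poly_closed by (simp add: UP_def fun_eq_iff hom_poly_def Polynomial.coeff_mult h_sum h_mult)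
  show "hom_poly (P \<oplus>\<^bsub>ring_of_type_algebra\<^esub> Q) = hom_poly P \<oplus>\<^bsub>UP S\<^esub> hom_poly Q"
    using hom_poly_closed by (simp add: UP_def fun_eq_iff hom_poly_def h_add)
next
  show "hom_poly \<one>\<^bsub>ring_of_type_algebra\<^esub> = \<one>\<^bsub>UP S\<^esub>"
    by (auto simp: UP_def hom_poly_def)
qed

lemma hom_poly_monom: "hom_poly (Polynomial.monom c n) = up_ring.monom (UP S) (h c) n"
  by (auto simp: UP_def hom_poly_def)

lemma hom_poly_surj:
  assumes "range h = carrier S"
  shows "range hom_poly = carrier (UP S)"
proof (intro equalityI subsetI)
  fix g assume g: "g \<in> carrier (UP S)"
  hence "g \<in> up S" by (simp add: UP_def)
  then obtain N where N: "bound \<zero> N g" by blast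
  have "\<forall>i. \<exists>q. h q = g i"
    using \<open>g \<in> up S\<close> assms by (metis imageE mem_upD)
  then obtain q where q: "\<And>i. h (q i) = g i" by metis
  \<comment> \<open>Preimages beyond the bound \<open>N\<close> are cut off; there both sides are
    zero.\<close>
  have "hom_poly (\<Sum>i\<le>N. Polynomial.monom (q i) i) = g"
  proof
    fix i
    show "hom_poly (\<Sum>i\<le>N. Polynomial.monom (q i) i) i = g i"
      using bound.bound[OF N, of i] by (cases "i \<le> N") (simp_all add: hom_poly_def Polynomial.coeff_sum q)
  qed
  thus "g \<in> range hom_poly" by blast
qed (use hom_poly_closed in \<open>auto simp: UP_def\<close>)

end

lemma chain_elt_hom: "type_ring_hom_cring (chain_ring e) (chain_elt e :: 'a poly \<Rightarrow> _)"
  and chain_elt_eq_0_iff: "chain_elt e q = \<zero>\<^bsub>chain_ring e\<^esub> \<longleftrightarrow> Polynomial.monom 1 e dvd q"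
  and chain_elt_surj: "range (chain_elt e :: 'a poly \<Rightarrow> _) = carrier (chain_ring e)"
  for q :: "'a::field poly"
proof -
  interpret R: cring "ring_of_type_algebra :: 'a poly ring" by (rule cring_from_type_algebra)
  interpret I: ideal "trunc_ideal e :: 'a poly set" ring_of_type_algebra
    unfolding trunc_ideal_def by (rule R.genideal_ideal) simp
  interpret Q: cring "chain_ring e :: 'a poly set ring"
    unfolding chain_ring_def by (rule I.quotient_is_cring) (rule R.is_cring)
  show "type_ring_hom_cring (chain_ring e) (chain_elt e :: 'a poly \<Rightarrow> _)"
    by unfold_locales (use I.rcos_ring_hom in \<open>simp add: chain_ring_def chain_elt_def[abs_def]\<close>)
  show "chain_elt e q = \<zero>\<^bsub>chain_ring e\<^esub> \<longleftrightarrow> Polynomial.monom 1 e dvd q"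
    unfolding chain_elt_def chain_ring_def
    by (subst I.rcos_eq_zero_iff) (simp_all add: trunc_ideal_def genideal_type_algebra)
  show "range (chain_elt e :: 'a poly \<Rightarrow> _) = carrier (chain_ring e)"
    using I.rcos_surj by (simp add: chain_ring_def chain_elt_def[abs_def])
qed

text \<open>The two successive quotients, by u^e in the coefficients and then by x^n - lam, are
  treated as one map out of F[u][x] whose kernel is congruence to 0;
  \<open>lift_poly_constacyclic\<close> then restricts that map to F[x].\<close>

lemma constacyclic_elt_hom:
  fixes la :: "'a::field poly" and e n :: nat
  assumes la1: "Polynomial.coeff la 1 \<noteq> 0" and e: "e > 0"
  defines "G \<equiv> Polynomial.monom 1 n - [:Polynomial.coeff la 0:]"
    and "lam \<equiv> chain_elt e la"
  shows "type_ring_hom_cring (constacyclic_ring e n lam) (constacyclic_elt e n lam)"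
    and "range (constacyclic_elt e n lam) = carrier (constacyclic_ring e n lam)"
    and "constacyclic_elt e n lam f = \<zero>\<^bsub>constacyclic_ring e n lam\<^esub> \<longleftrightarrow> G ^ e dvd f"
proof -
  interpret c: type_ring_hom_cring "chain_ring e" "chain_elt e :: 'a poly \<Rightarrow> _"
    by (rule chain_elt_hom)
  interpret M: type_ring_hom_cring "UP (chain_ring e)" c.hom_poly
    by (rule c.hom_poly_hom)
  define P where "P = UP (chain_ring e :: 'a poly set ring)"
  define gen where "gen = Polynomial.monom 1 n - [:la:]"
  have M_gen: "c.hom_poly gen = up_ring.monom P \<one>\<^bsub>chain_ring e\<^esub> n \<ominus>\<^bsub>P\<^esub> up_ring.monom P lam 0"
    by (simp add: gen_def P_def M.h_diff c.hom_poly_monom lam_def flip: Polynomial.monom_0)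
  have M_surj: "range c.hom_poly = carrier P"
    unfolding P_def using chain_elt_surj by (rule c.hom_poly_surj)
  define I where "I = constacyclic_ideal e n lam"
  have I_PIdl: "I = PIdl\<^bsub>P\<^esub> (c.hom_poly gen)"
    unfolding I_def constacyclic_ideal_def Let_def M_gen[symmetric, unfolded P_def] P_def
    by (rule M.S.cgenideal_eq_genideal[symmetric]) simp
  interpret I: ideal I P
    unfolding I_PIdl P_def by (rule M.S.cgenideal_ideal) simp
  have ring: "constacyclic_ring e n lam = P Quot I"
    by (simp add: constacyclic_ring_def P_def I_def)
  have elt: "constacyclic_elt e n lam f = I +>\<^bsub>P\<^esub> c.hom_poly (lift_poly f)" for f
    by (simp add: constacyclic_elt_def P_def I_def c.hom_poly_def[abs_def])
  interpret Q: cring "constacyclic_ring e n lam"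
    unfolding ring by (rule I.quotient_is_cring) (simp add: P_def M.S.is_cring)
  interpret T: type_ring_hom_cring "constacyclic_ring e n lam" "\<lambda>Q. I +>\<^bsub>P\<^esub> c.hom_poly Q"
  proof
    show "(\<lambda>Q. I +>\<^bsub>P\<^esub> c.hom_poly Q) \<in> ring_hom ring_of_type_algebra (constacyclic_ring e n lam)"
      using ring_hom_trans[OF M.hom I.rcos_ring_hom[unfolded P_def]]
      by (simp add: ring P_def o_def)
  qed
  \<comment> \<open>Surjectivity of \<open>c.hom_poly\<close> lets the cofactor in the principal
    ideal be lifted to F[u][x]. What remains is a polynomial whose coefficients all vanish modulo
    u^e, that is, a multiple of the constant u^e.\<close>
  have T_zero: "I +>\<^bsub>P\<^esub> c.hom_poly Q = \<zero>\<^bsub>constacyclic_ring e n lam\<^esub> \<longleftrightarrow> constacyclic_cong e n la Q 0" for Q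
  proof -
    have "I +>\<^bsub>P\<^esub> c.hom_poly Q = \<zero>\<^bsub>constacyclic_ring e n lam\<^esub> \<longleftrightarrow> c.hom_poly Q \<in> I"
      unfolding ring using M_surj by (intro I.rcos_eq_zero_iff) auto
    also have "\<dots> \<longleftrightarrow> (\<exists>b. c.hom_poly Q = c.hom_poly b \<otimes>\<^bsub>P\<^esub> c.hom_poly gen)"
      unfolding I_PIdl cgenideal_def M_surj[symmetric] by auto
    also have "\<dots> \<longleftrightarrow> (\<exists>b. c.hom_poly (Q - b * gen) = \<zero>\<^bsub>P\<^esub>)"
      by (simp add: M.h_diff M.h_mult P_def)
    also have "\<dots> \<longleftrightarrow> (\<exists>b. \<forall>i. Polynomial.monom 1 e dvd Polynomial.coeff (Q - b * gen) i)"
      by (simp add: P_def UP_def fun_eq_iff c.hom_poly_def chain_elt_eq_0_iff)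
    also have "\<dots> \<longleftrightarrow> (\<exists>b. [:Polynomial.monom 1 e:] dvd Q - b * gen)"
      by (simp only: const_poly_dvd_iff)
    also have "\<dots> \<longleftrightarrow> constacyclic_cong e n la Q 0"
      unfolding constacyclic_cong_def gen_def[symmetric] dvd_def
      by (auto simp: algebra_simps)
    finally show ?thesis .
  qed
  have T_eq: "I +>\<^bsub>P\<^esub> c.hom_poly Q = I +>\<^bsub>P\<^esub> c.hom_poly Q'" if "constacyclic_cong e n la Q Q'" for Q Q'
  proof -
    have "constacyclic_cong e n la (Q - Q') 0" using that by (simp add: constacyclic_cong_def)
    thus ?thesis unfolding T_zero[symmetric] T.h_diff by simp
  qed
  show "constacyclic_elt e n lam f = \<zero>\<^bsub>constacyclic_ring e n lam\<^esub> \<longleftrightarrow> G ^ e dvd f"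
    unfolding elt T_zero G_def by (rule lift_poly_constacyclic[OF la1 e])
  have "range (constacyclic_elt e n lam) = range (\<lambda>Q. I +>\<^bsub>P\<^esub> c.hom_poly Q)"
  proof (rule equalityI)
    show "range (\<lambda>Q. I +>\<^bsub>P\<^esub> c.hom_poly Q) \<subseteq> range (constacyclic_elt e n lam)"
    proof (rule image_subsetI)
      fix Q
      obtain f where "constacyclic_cong e n la Q (lift_poly f)"
        using lift_poly_constacyclic(1)[OF la1 e] by blast
      from T_eq[OF this] show "I +>\<^bsub>P\<^esub> c.hom_poly Q \<in> range (constacyclic_elt e n lam)"
        unfolding elt[symmetric] by (rule range_eqI)
    qed
  qed (auto simp only: elt)
  moreover have "carrier (constacyclic_ring e n lam) = range (\<lambda>Q. I +>\<^bsub>P\<^esub> c.hom_poly Q)"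
    unfolding ring I.rcos_surj[symmetric] M_surj[symmetric] by (simp add: image_image)
  ultimately show "range (constacyclic_elt e n lam) = carrier (constacyclic_ring e n lam)"
    by (simp only:)
  show "type_ring_hom_cring (constacyclic_ring e n lam) (constacyclic_elt e n lam)"
  proof
    show "constacyclic_elt e n lam \<in> ring_hom ring_of_type_algebra (constacyclic_ring e n lam)"
      by (rule ring_hom_memI)
        (simp_all add: elt lift_poly_mult lift_poly_add T.h_mult T.h_add T.h_one del: M.h_one)
  qed
qed

subsection \<open>Ideals of a quotient of $F[x]$\<close>

text \<open>Vanishing coefficients are used instead of a bound on the degree because the zero
  polynomial has degree 0 and would be lost at \<open>N = 0\<close>.\<close>

lemma card_poly_coeffs_zero_from:
  "card {k :: 'a::comm_semiring_1 poly. \<forall>i\<ge>N. Polynomial.coeff k i = 0} = CARD('a) ^ N"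
proof (induction N)
  case 0
  have "{k :: 'a poly. \<forall>i\<ge>0. Polynomial.coeff k i = 0} = {0}"
    by (auto intro: poly_eqI)
  thus ?case by simp
next
  case (Suc N)
  let ?S = "\<lambda>N. {k :: 'a poly. \<forall>i\<ge>N. Polynomial.coeff k i = 0}"
  have "bij_betw (\<lambda>(a, k). pCons a k) (UNIV \<times> ?S N) (?S (Suc N))"
    unfolding bij_betw_def
  proof (intro conjI equalityI subsetI)
    fix k assume k: "k \<in> ?S (Suc N)"
    obtain a k' where "k = pCons a k'" by (cases k)
    moreover from this k have "k' \<in> ?S N" by (fastforce simp: coeff_pCons split: nat.splits)
    ultimately show "k \<in> (\<lambda>(a, k). pCons a k) ` (UNIV \<times> ?S N)" by auto
  qed (auto simp: inj_on_def coeff_pCons split: nat.splits)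
  from bij_betw_same_card[OF this] show ?case
    by (simp add: card_cartesian_product Suc.IH)
qed

text \<open>The ring F[x]/(H) up to isomorphism, given by a surjection and its kernel so that no
  isomorphism needs to be built. It is later instantiated with H = G^e.\<close>

locale poly_quotient = type_ring_hom_cring S \<phi>
  for S :: "('b, 'c) ring_scheme" (structure) and \<phi> :: "'a::field poly \<Rightarrow> 'b" +
  fixes H :: "'a poly"
  assumes surj: "range \<phi> = carrier S"
    and kernel: "\<phi> f = \<zero> \<longleftrightarrow> H dvd f"
    and H_nonzero: "H \<noteq> 0"
begin

lemma genideal_image: "Idl {\<phi> h} = range (\<lambda>k. \<phi> (k * h))"
proof -
  have "Idl {\<phi> h} = PIdl (\<phi> h)"
    by (rule S.cgenideal_eq_genideal[symmetric]) simp
  also have "\<dots> = range (\<lambda>k. \<phi> (k * h))"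
    unfolding cgenideal_def surj[symmetric] by (auto simp: h_mult)
  finally show ?thesis .
qed

text \<open>The preimage of \<open>I\<close> in F[x] is an ideal containing H. Division with
  remainder shows that an element of least degree generates it, and so divides H.\<close>

lemma ideal_generator:
  assumes "ideal I S"
  obtains h where "Polynomial.lead_coeff h = 1" "h dvd H" "I = Idl {\<phi> h}"
proof -
  interpret I: ideal I S by fact
  \<comment> \<open>H maps to zero, so the preimage has a nonzero element even when \<open>I\<close>
    is the zero ideal.\<close>
  have "\<phi> H \<in> I" using kernel[of H] by simp
  then obtain g where g: "g \<noteq> 0" "\<phi> g \<in> I"
    and min: "\<And>f. f \<noteq> 0 \<Longrightarrow> \<phi> f \<in> I \<Longrightarrow> Polynomial.degree g \<le> Polynomial.degree f"
    using ex_has_least_nat[of "\<lambda>f. f \<noteq> 0 \<and> \<phi> f \<in> I" H Polynomial.degree] H_nonzero by blast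
  define h where "h = Polynomial.smult (inverse (Polynomial.lead_coeff g)) g"
  have h: "Polynomial.lead_coeff h = 1" "h \<noteq> 0" "Polynomial.degree h = Polynomial.degree g"
    using g(1) by (simp_all add: h_def)
  have h_in: "\<phi> h \<in> I"
  proof -
    have "h = [:inverse (Polynomial.lead_coeff g):] * g" by (simp add: h_def)
    thus ?thesis using g(2) I.I_l_closed by (simp only: h_mult h_closed)
  qed
  have dvd: "h dvd f" if "\<phi> f \<in> I" for f
  proof -
    have "\<phi> (f div h * h) \<in> I" using h_in I.I_l_closed by (simp only: h_mult h_closed)
    hence "\<phi> (f - f div h * h) \<in> I" using that by (simp only: h_diff S.minus_eq I.a_closed I.a_inv_closed)
    hence "\<phi> (f mod h) \<in> I" by (simp only: minus_div_mult_eq_mod)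
    hence "f mod h = 0" using min degree_mod_less[OF h(2), of f] h(3) by fastforce
    thus ?thesis by (simp add: mod_eq_0_iff_dvd)
  qed
  show ?thesis
  proof
    show "I = Idl {\<phi> h}"
    proof (intro equalityI)
      show "I \<subseteq> Idl {\<phi> h}"
      proof
        fix x assume x: "x \<in> I"
        hence "x \<in> range \<phi>" using surj I.a_subset by auto
        then obtain f where f: "x = \<phi> f" by blast
        with x dvd have "h dvd f" by blast
        thus "x \<in> Idl {\<phi> h}"
          unfolding genideal_image f by (auto simp: dvd_def mult.commute)
      qed
      show "Idl {\<phi> h} \<subseteq> I"
        using h_in by (intro S.genideal_minimal assms) simp
    qed
    show "h dvd H" using \<open>\<phi> H \<in> I\<close> by (rule dvd)
  qed fact
qed

text \<open>With H = h c, the multiples k h and k' h have the same image exactly when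
  \<open>c\<close> divides k - k'. The ideal is thus counted by residues modulo \<open>c\<close>,
  represented by the set \<open>K\<close>.\<close>

lemma card_genideal:
  assumes "h dvd H"
  shows "card (Idl {\<phi> h}) = CARD('a) ^ (Polynomial.degree H - Polynomial.degree h)"
proof -
  from assms obtain c where c: "H = h * c" by (elim dvdE)
  with H_nonzero have nz: "h \<noteq> 0" "c \<noteq> 0" by auto
  have deg: "Polynomial.degree H - Polynomial.degree h = Polynomial.degree c"
    using nz by (simp add: c Polynomial.degree_mult_eq)
  define K where "K = {k :: 'a poly. \<forall>i\<ge>Polynomial.degree c. Polynomial.coeff k i = 0}"
  have small: "k = 0" if "c dvd k" "k \<in> K" for k
  proof (rule ccontr)
    assume "k \<noteq> 0"
    with that(1) have "Polynomial.degree c \<le> Polynomial.degree k"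
      by (rule Polynomial.dvd_imp_degree_le)
    with that(2) \<open>k \<noteq> 0\<close> show False by (auto simp: K_def)
  qed
  have "bij_betw (\<lambda>k. \<phi> (k * h)) K (Idl {\<phi> h})"
    unfolding bij_betw_def genideal_image
  proof (intro conjI equalityI)
    show "inj_on (\<lambda>k. \<phi> (k * h)) K"
    proof (rule inj_onI)
      fix k k' assume k: "k \<in> K" "k' \<in> K" and eq: "\<phi> (k * h) = \<phi> (k' * h)"
      have "\<phi> ((k - k') * h) = \<zero>"
        using eq by (simp add: left_diff_distrib h_diff S.r_right_minus_eq)
      hence "h * c dvd h * (k - k')" by (simp add: kernel c mult.commute)
      hence "c dvd k - k'" using nz by simp
      moreover have "k - k' \<in> K" using k by (simp add: K_def)
      ultimately show "k = k'" using small by fastforce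
    qed
    show "range (\<lambda>k. \<phi> (k * h)) \<subseteq> (\<lambda>k. \<phi> (k * h)) ` K"
    proof
      fix x assume "x \<in> range (\<lambda>k. \<phi> (k * h))"
      then obtain k where x: "x = \<phi> (k * h)" by blast
      \<comment> \<open>A multiple of \<open>c\<close> times \<open>h\<close> is a multiple of H and
        disappears under the map, so only the remainder of \<open>k\<close> matters.\<close>
      have "(k div c) * H + (k mod c) * h = (k div c * c + k mod c) * h"
        unfolding c by (simp only: distrib_right mult.commute[of h c] mult.assoc)
      hence "k * h = (k div c) * H + (k mod c) * h"
        by (simp only: div_mult_mod_eq)
      moreover have "\<phi> ((k div c) * H) = \<zero>" by (simp add: kernel)
      ultimately have "x = \<phi> ((k mod c) * h)" by (simp add: x h_add)
      moreover have "k mod c \<in> K"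
        using degree_mod_less[OF nz(2), of k] by (auto simp: K_def coeff_eq_0)
      ultimately show "x \<in> (\<lambda>k. \<phi> (k * h)) ` K" by blast
    qed
  qed blast
  from bij_betw_same_card[OF this] show ?thesis
    unfolding deg K_def card_poly_coeffs_zero_from by simp
qed

lemma principal_ideal_ring: "principal_ideal_ring S"
  unfolding principal_ideal_ring_def
proof (intro conjI allI impI S.is_cring)
  fix I assume I: "ideal I S"
  then obtain h where "I = Idl {\<phi> h}" by (rule ideal_generator)
  thus "principalideal I S" using I by (intro principalidealI bexI[of _ "\<phi> h"]) auto
qed

end

subsection \<open>Constacyclic codes\<close>

lemma prod_mset_sum_replicate:
  fixes f :: "'i \<Rightarrow> 'b::comm_monoid_mult"
  assumes "finite J"
  shows "prod_mset (\<Sum>i\<in>J. replicate_mset (t i) (f i)) = (\<Prod>i\<in>J. f i ^ t i)"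
  using assms by (induction J rule: finite_induct) simp_all

lemma count_sum_replicate:
  assumes "finite J" "inj_on f J" "j \<in> J"
  shows "count (\<Sum>i\<in>J. replicate_mset (t i) (f i)) (f j) = t j"
proof -
  have "count (\<Sum>i\<in>J. replicate_mset (t i) (f i)) (f j) = (\<Sum>i\<in>J. if i = j then t i else 0)"
    unfolding count_sum using assms(2,3) by (intro sum.cong) (auto simp: inj_on_eq_iff)
  thus ?thesis using assms(1,3) by simp
qed

text \<open>Leading coefficients multiply, so normalizing the factors of a monic polynomial leaves
  the product unchanged.\<close>

lemma prod_mset_monic_multiples:
  "prod_mset (image_mset (\<lambda>g. Polynomial.smult (inverse (Polynomial.lead_coeff g)) g) A)
     = Polynomial.smult (inverse (Polynomial.lead_coeff (prod_mset A))) (prod_mset A)"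
  for A :: "'a::field poly multiset"
  by (induction A) (simp_all add: Polynomial.lead_coeff_mult mult.commute)

lemma monic_irreducible_smult_inverse:
  fixes g :: "'a::field poly"
  assumes "comm_semiring_1_class.irreducible g"
  shows "monic_irreducible (Polynomial.smult (inverse (Polynomial.lead_coeff g)) g)"
proof -
  have "g \<noteq> 0" using assms by auto
  hence "[:inverse (Polynomial.lead_coeff g):] dvd 1" by (simp add: is_unit_iff_degree)
  hence "comm_semiring_1_class.irreducible ([:inverse (Polynomial.lead_coeff g):] * g)"
    using assms irreducible_mult_unit_left by blast
  with \<open>g \<noteq> 0\<close> show ?thesis by simp
qed

text \<open>The divisor is a sub-multiset of the one with \<open>N\<close> copies of each
  \<open>f i\<close>. As \<open>f\<close> is injective, \<open>t i\<close> can be read off as the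
  multiplicity of \<open>f i\<close>.\<close>

lemma monic_dvd_prod_power:
  fixes f :: "'i \<Rightarrow> 'a::field poly"
  assumes J: "finite J" "inj_on f J" and f: "\<And>i. i \<in> J \<Longrightarrow> monic_irreducible (f i)"
    and h: "h dvd (\<Prod>i\<in>J. f i ^ N)" "Polynomial.lead_coeff h = 1"
  obtains t where "\<forall>i\<in>J. t i \<le> N" "h = (\<Prod>i\<in>J. f i ^ t i)"
proof -
  define M where "M = (\<Sum>i\<in>J. replicate_mset N (f i))"
  have M: "g \<in> f ` J" if "g \<in># M" for g
    using that J(1) by (auto simp: M_def set_mset_sum split: if_splits)
  have "\<forall>g\<in>#M. monic_irreducible g" using M f by auto
  moreover have "h dvd prod_mset M"
    using h(1) prod_mset_sum_replicate[OF J(1), of "\<lambda>_. N" f] by (simp add: M_def)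
  ultimately obtain B where B: "B \<subseteq># M" "h = prod_mset B"
    using monic_dvd_prod_monic_irreducible h(2) by blast
  have "h = (\<Prod>g\<in>set_mset B. g ^ count B g)"
    unfolding B(2) by (rule prod_mset_multiplicity)
  also have "\<dots> = (\<Prod>g\<in>f ` J. g ^ count B g)"
    using M B(1) J(1) by (intro prod.mono_neutral_left) (auto simp: not_in_iff dest: mset_subset_eqD)
  also have "\<dots> = (\<Prod>i\<in>J. f i ^ count B (f i))"
    using J(2) by (simp add: prod.reindex)
  finally have "h = (\<Prod>i\<in>J. f i ^ count B (f i))" .
  moreover have "\<forall>i\<in>J. count B (f i) \<le> N"
    using mset_subset_eq_count[OF B(1)] count_sum_replicate[OF J, of _ "\<lambda>_. N"]
    unfolding M_def by metis
  ultimately show ?thesis using that[of "\<lambda>i. count B (f i)"] by simp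
qed

lemma degree_prod_power:
  fixes f :: "'i \<Rightarrow> 'a::field poly"
  assumes "\<And>i. i \<in> J \<Longrightarrow> f i \<noteq> 0"
  shows "Polynomial.degree (\<Prod>i\<in>J. f i ^ t i) = (\<Sum>i\<in>J. t i * Polynomial.degree (f i))"
  using assms by (subst degree_prod_eq_sum_degree) (auto simp: Polynomial.degree_power_eq)

lemma coeff_sum_monom_shift:
  "Polynomial.coeff (\<Sum>i=1..e. Polynomial.monom (\<alpha> i) (i - 1)) j = (if j < e then \<alpha> (Suc j) else 0)"
proof -
  have "Polynomial.coeff (\<Sum>i=1..e. Polynomial.monom (\<alpha> i) (i - 1)) j
      = (\<Sum>i=1..e. if i = Suc j then \<alpha> i else 0)"
    unfolding Polynomial.coeff_sum by (intro sum.cong) auto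
  thus ?thesis by simp
qed

text \<open>In the cardinality \<open>e\<close> multiplies \<open>n\<close> alone, whereas the
  opening formula has it before the whole bracket: G^e has degree e n, and each factor f_i lowers
  the dimension over F by its degree once. If every \<open>t i\<close> equals p^s e, the ideal is
  zero and the exponent is 0, as it must be.\<close>

theorem theorem4p3:
  fixes p r m s e n l :: nat
    and \<alpha>\<^sub>0 :: "'a::{field,finite}"
    and \<alpha> :: "nat \<Rightarrow> 'a"
    and f :: "nat \<Rightarrow> 'a poly"
    and lam :: "'a poly set"
    and RR :: "(nat \<Rightarrow> 'a poly set) set ring"
  assumes "normalization_semidom_class.prime p" and "r \<ge> 1" and "m \<ge> 1" and "e \<ge> 2"
    and "gcd m p = 1"
    and "n = m * p ^ s"
    and "CARD('a) = p ^ r"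
    and "lam = chain_elt e (\<Sum>i=1..e. Polynomial.monom (\<alpha> i) (i - 1))"
    and "\<alpha> 1 = \<alpha>\<^sub>0 ^ (p ^ s)" and "\<alpha> 1 \<noteq> 0" and "\<alpha> 2 \<noteq> 0"
    and "bij_betw f {1..l}
           {g. comm_semiring_1_class.irreducible g \<and> Polynomial.lead_coeff g = 1 \<and>
               g dvd Polynomial.monom 1 m - [:\<alpha>\<^sub>0:]}"
    and "RR = constacyclic_ring e n lam"
  shows
    "Polynomial.monom 1 n - [:\<alpha> 1:] = (\<Prod>i=1..l. f i ^ (p ^ s)) \<and>
     (\<forall>A. (\<forall>g\<in>#A. comm_semiring_1_class.irreducible g) \<and>
          prod_mset A = Polynomial.monom 1 n - [:\<alpha> 1:] \<longrightarrow>
          image_mset (\<lambda>g. Polynomial.smult (inverse (Polynomial.lead_coeff g)) g) A =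
            (\<Sum>i=1..l. replicate_mset (p ^ s) (f i))) \<and>
     principal_ideal_ring RR \<and>
     {I. ideal I RR} =
       {Idl\<^bsub>RR\<^esub> {constacyclic_elt e n lam (\<Prod>i=1..l. f i ^ t i)} | t.
          \<forall>i\<in>{1..l}. t i \<le> p ^ s * e} \<and>
     (\<forall>t. (\<forall>i\<in>{1..l}. t i \<le> p ^ s * e) \<longrightarrow>
        real (card (Idl\<^bsub>RR\<^esub> {constacyclic_elt e n lam (\<Prod>i=1..l. f i ^ t i)})) =
          real p powi
            (int r * (int e * int n - (\<Sum>i=1..l. int (t i) * int (Polynomial.degree (f i))))))"
proof -
  define G where "G = Polynomial.monom 1 n - [:\<alpha> 1:]"
  have char: "CHAR('a) = p"
    using CHAR_eq_of_CARD_eq_prime_power assms(1,7) by blast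
  have p: "p > 0" "\<not> p dvd 1" using assms(1) by (auto simp: prime_gt_0_nat)
  have n: "n > 0" using assms(3,6) p by simp
  have "\<not> p dvd m" using assms(5) p(2) by (metis dvd_refl gcd_greatest)
  \<comment> \<open>Coprimality of \<open>m\<close> and \<open>p\<close> makes \<open>m\<close>
    invertible in the field, which is the condition for x^m - alpha_0 to be squarefree.\<close>
  hence m: "of_nat m \<noteq> (0 :: 'a)" by (simp add: of_nat_eq_0_iff_char_dvd char)
  have \<alpha>\<^sub>0: "\<alpha>\<^sub>0 \<noteq> 0" using assms(9,10) p by (auto simp: power_0_left)
  have f: "monic_irreducible (f i)" if "i \<in> {1..l}" for i
    using bij_betwE[OF assms(12)] that by auto
  have inj: "inj_on f {1..l}" using assms(12) by (rule bij_betw_imp_inj_on)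
  have fin: "finite {1..l}" by simp
  have "(\<Prod>i=1..l. f i ^ (p ^ s)) = (Polynomial.monom 1 m - [:\<alpha>\<^sub>0:]) ^ (p ^ s)"
    unfolding binomial_factorization[OF m \<alpha>\<^sub>0 assms(12)] by (rule prod_power_distrib[symmetric])
  also have "\<dots> = G"
    using binomial_power_char[of m \<alpha>\<^sub>0 s] assms(1,6,9) by (simp add: G_def char)
  finally have G_eq: "G = (\<Prod>i=1..l. f i ^ (p ^ s))" by (rule sym)
  have Ge_eq: "G ^ e = (\<Prod>i=1..l. f i ^ (p ^ s * e))"
    unfolding G_eq prod_power_distrib by (simp add: power_mult)
  have deg_G: "Polynomial.degree G = n" and lc_G: "Polynomial.lead_coeff G = 1"
    unfolding G_def by (rule lead_coeff_binomial[OF n])+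
  have "G \<noteq> 0" using lc_G by auto

  have "image_mset (\<lambda>g. Polynomial.smult (inverse (Polynomial.lead_coeff g)) g) A
      = (\<Sum>i=1..l. replicate_mset (p ^ s) (f i))"
    if A: "\<forall>g\<in>#A. comm_semiring_1_class.irreducible g" "prod_mset A = G" for A
  proof (rule monic_irreducible_factorization_unique)
    show "prod_mset (image_mset (\<lambda>g. Polynomial.smult (inverse (Polynomial.lead_coeff g)) g) A)
        = prod_mset (\<Sum>i=1..l. replicate_mset (p ^ s) (f i))"
      unfolding prod_mset_monic_multiples prod_mset_sum_replicate[OF fin] A(2) lc_G
      by (simp add: G_eq)
    show "\<forall>g\<in>#image_mset (\<lambda>g. Polynomial.smult (inverse (Polynomial.lead_coeff g)) g) A.
        monic_irreducible g"
      using A(1) monic_irreducible_smult_inverse by auto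
    show "\<forall>g\<in>#(\<Sum>i=1..l. replicate_mset (p ^ s) (f i)). monic_irreducible g"
      using f by (auto simp: set_mset_sum split: if_splits)
  qed
  hence unique: "\<forall>A. (\<forall>g\<in>#A. comm_semiring_1_class.irreducible g) \<and> prod_mset A = G \<longrightarrow>
      image_mset (\<lambda>g. Polynomial.smult (inverse (Polynomial.lead_coeff g)) g) A =
        (\<Sum>i=1..l. replicate_mset (p ^ s) (f i))"
    by blast

  define la where "la = (\<Sum>i=1..e. Polynomial.monom (\<alpha> i) (i - 1))"
  \<comment> \<open>The \<alpha> are numbered from 1, so \<open>\<alpha> 2\<close> is the
    coefficient of u; since e is at least 2, that term is present in the sum.\<close>
  have la0: "Polynomial.coeff la 0 = \<alpha> 1" and la1: "Polynomial.coeff la 1 \<noteq> 0"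
    using assms(4,11) unfolding la_def coeff_sum_monom_shift by (simp_all add: numeral_2_eq_2)
  have e: "e > 0" using assms(4) by simp
  have lam: "lam = chain_elt e la" using assms(8) by (simp add: la_def)
  note hom = constacyclic_elt_hom[OF la1 e, of n, folded lam, unfolded la0,
      folded G_def, folded assms(13)]
  interpret RR: poly_quotient RR "constacyclic_elt e n lam" "G ^ e"
    by (intro poly_quotient.intro poly_quotient_axioms.intro hom) (use \<open>G \<noteq> 0\<close> in simp)

  have ideals: "{I. ideal I RR} =
       {Idl\<^bsub>RR\<^esub> {constacyclic_elt e n lam (\<Prod>i=1..l. f i ^ t i)} | t.
          \<forall>i\<in>{1..l}. t i \<le> p ^ s * e}"
  proof (intro equalityI subsetI)
    fix I assume "I \<in> {I. ideal I RR}"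
    then obtain h where h: "Polynomial.lead_coeff h = 1" "h dvd G ^ e"
      "I = Idl\<^bsub>RR\<^esub> {constacyclic_elt e n lam h}"
      using RR.ideal_generator by blast
    obtain t where "\<forall>i\<in>{1..l}. t i \<le> p ^ s * e" "h = (\<Prod>i=1..l. f i ^ t i)"
      using monic_dvd_prod_power[OF fin inj f h(2)[unfolded Ge_eq] h(1)] by blast
    with h(3) show "I \<in> {Idl\<^bsub>RR\<^esub> {constacyclic_elt e n lam (\<Prod>i=1..l. f i ^ t i)} | t.
        \<forall>i\<in>{1..l}. t i \<le> p ^ s * e}"
      by blast
  qed (auto intro!: RR.S.genideal_ideal)

  have card: "real (card (Idl\<^bsub>RR\<^esub> {constacyclic_elt e n lam (\<Prod>i=1..l. f i ^ t i)})) =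
      real p powi
        (int r * (int e * int n - (\<Sum>i=1..l. int (t i) * int (Polynomial.degree (f i)))))"
    if t: "\<forall>i\<in>{1..l}. t i \<le> p ^ s * e" for t
  proof -
    define h where "h = (\<Prod>i=1..l. f i ^ t i)"
    have h_dvd: "h dvd G ^ e"
      unfolding h_def Ge_eq using t by (intro prod_dvd_prod le_imp_power_dvd) auto
    have deg_h: "Polynomial.degree h = (\<Sum>i=1..l. t i * Polynomial.degree (f i))"
      unfolding h_def by (rule degree_prod_power) (use f in fastforce)
    have deg_Ge: "Polynomial.degree (G ^ e) = e * n"
      using \<open>G \<noteq> 0\<close> by (simp add: Polynomial.degree_power_eq deg_G)
    \<comment> \<open>As \<open>h\<close> divides G^e, the natural subtraction is exact and the
      integer exponent is nonnegative.\<close>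
    have le: "Polynomial.degree h \<le> e * n"
      using Polynomial.dvd_imp_degree_le[OF h_dvd] \<open>G \<noteq> 0\<close> deg_Ge by simp
    have "int r * (int e * int n - (\<Sum>i=1..l. int (t i) * int (Polynomial.degree (f i))))
        = int (r * (e * n - Polynomial.degree h))"
      using le by (simp add: of_nat_diff) (simp add: deg_h)
    moreover have "card (Idl\<^bsub>RR\<^esub> {constacyclic_elt e n lam h}) = p ^ (r * (e * n - Polynomial.degree h))"
      unfolding RR.card_genideal[OF h_dvd] deg_Ge assms(7) by (rule power_mult[symmetric])
    ultimately show ?thesis
      unfolding h_def[symmetric] by (simp only: power_int_of_nat of_nat_power)
  qed
  show ?thesis
    using G_eq unique RR.principal_ideal_ring ideals card unfolding G_def by blast
qed

end
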